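(* If $\vdash G\triangleright N$ and $G\parallel\mathcal M\xrightarrow{\beta}G'\parallel\mathcal M'$, then there is a network $N'$ such that $N\parallel\mathcal M\xrightarrow{\beta}N'\parallel\mathcal M'$ and $\vdash G'\triangleright N'$.
   Context: Participants are ranged over by $\mathsf p,\mathsf q,\mathsf r,\mathsf s$ and labels by $\lambda$. Processes are the possibly infinite but regular terms coinductively generated by $P ::= \mathbf 0 \mid \mathsf p!\{\lambda_i;P_i\}_{i\in I}\mid \mathsf p?\{\lambda_i;P_i\}_{i\in I}$, with $I$ finite nonempty and the $\lambda_i$ pairwise distinct. A network is $N=\mathsf p_1[\![P_1]\!]\parallel\cdots\parallel\mathsf p_n[\![P_n]\!]$ with $n>0$ and pairwise distinct $\mathsf p_i$, taken modulo permutation and adding/removing components $\mathsf p[\![\mathbf 0]\!]$; $\mathrm{plays}(N)$ is the set of $\mathsf p$ with $N\equiv\mathsf p[\![P]\!]\parallel N'$, $P\neq\mathbf 0$. A message is a triple $\langle\mathsf p,\lambda,\mathsf q\rangle$; a queue $\mathcal M$ is a finite sequence of messages ($\emptyset$ empty, $\cdot$ concatenation), taken modulo the congruence $\equiv$ generated by swapping adjacent messages $\langle\mathsf p,\lambda,\mathsf q\rangle\cdot\langle\mathsf r,\lambda',\mathsf s\rangle\equiv\langle\mathsf r,\lambda',\mathsf s\rangle\cdot\langle\mathsf p,\lambda,\mathsf q\rangle$ whenever $\mathsf p\neq\mathsf r$ or $\mathsf q\neq\mathsf s$. A session is $N\parallel\mathcal M$. Communications are $\beta::=\mathsf p\mathsf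 q!\lambda\mid\mathsf p\mathsf q?\lambda$ with $\mathrm{play}(\mathsf p\mathsf q!\lambda)=\mathsf p$, $\mathrm{play}(\mathsf p\mathsf q?\lambda)=\mathsf q$. Sessions reduce by: $\mathsf p[\![\mathsf q!\{\lambda_i;P_i\}_{i\in I}]\!]\parallel N\parallel\mathcal M\xrightarrow{\mathsf p\mathsf q!\lambda_h}\mathsf p[\![P_h]\!]\parallel N\parallel\mathcal M\cdot\langle\mathsf p,\lambda_h,\mathsf q\rangle$ and $\mathsf q[\![\mathsf p?\{\lambda_i;Q_i\}_{i\in I}]\!]\parallel N\parallel\langle\mathsf p,\lambda_h,\mathsf q\rangle\cdot\mathcal M\xrightarrow{\mathsf p\mathsf q?\lambda_h}\mathsf q[\![Q_h]\!]\parallel N\parallel\mathcal M$, for $h\in I$. Global types are the possibly infinite regular terms coinductively generated by $G ::= \mathsf{End}\mid \mathsf p\mathsf q!\{\lambda_i;G_i\}_{i\in I}\mid\mathsf p\mathsf q?\{\lambda_i;G_i\}_{i\in I}$ ($I$ finite nonempty, $\mathsf p\neq\mathsf q$, $\lambda_i$ pairwise distinct). $\mathrm{play}(\mathsf p\mathsf q!\{\ldots\})=\mathsf p$, $\mathrm{play}(\mathsf p\mathsf q?\{\ldots\})=\mathsf q$; $\mathrm{plays}(G)$ is the least set with $\mathrm{plays}(\mathsf{End})=\emptyset$ and $\mathrm{plays}(G)=\{\mathrm{play}(G)\}\cup\bigcup_i\mathrm{plays}(G_i)$ for a choice $G$ with continuations $G_i$. Typing $\vdash G\triangleright N$ is defined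 coinductively by: (End) $\vdash\mathsf{End}\triangleright\mathsf p[\![\mathbf 0]\!]$; (Out) if for all $i\in I$, $\vdash G_i\triangleright\mathsf p[\![P_i]\!]\parallel N$ and $\mathrm{plays}(G_i)\setminus\{\mathsf p\}=\mathrm{plays}(N)$, then $\vdash\mathsf p\mathsf q!\{\lambda_i;G_i\}_{i\in I}\triangleright\mathsf p[\![\mathsf q!\{\lambda_i;P_i\}_{i\in I}]\!]\parallel N$; (In) if $I\subseteq J$ and for all $i\in I$, $\vdash G_i\triangleright\mathsf p[\![P_i]\!]\parallel N$ and $\mathrm{plays}(G_i)\setminus\{\mathsf p\}=\mathrm{plays}(N)$, then $\vdash\mathsf q\mathsf p?\{\lambda_i;G_i\}_{i\in I}\triangleright\mathsf p[\![\mathsf q?\{\lambda_j;P_j\}_{j\in J}]\!]\parallel N$. A type configuration is $G\parallel\mathcal M$; its transitions are defined inductively (queues modulo $\equiv$) by: (Top-Out) $\mathsf p\mathsf q!\{\lambda_i;G_i\}_{i\in I}\parallel\mathcal M\xrightarrow{\mathsf p\mathsf q!\lambda_h}G_h\parallel\mathcal M\cdot\langle\mathsf p,\lambda_h,\mathsf q\rangle$ for $h\in I$; (Top-In) $\mathsf p\mathsf q?\{\lambda_i;G_i\}_{i\in I}\parallel\langle\mathsf p,\lambda_h,\mathsf q\rangle\cdot\mathcal M\xrightarrow{\mathsf p\mathsf q?\lambda_h}G_h\parallel\mathcal M$ for $h\in I$; (Inside-Out) if $\mathsf p\neq\mathrm{play}(\beta)$ and $G_i\parallel\mathcal M\cdot\langle\mathsf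 p,\lambda_i,\mathsf q\rangle\xrightarrow{\beta}G'_i\parallel\mathcal M'\cdot\langle\mathsf p,\lambda_i,\mathsf q\rangle$ for all $i\in I$, then $\mathsf p\mathsf q!\{\lambda_i;G_i\}_{i\in I}\parallel\mathcal M\xrightarrow{\beta}\mathsf p\mathsf q!\{\lambda_i;G'_i\}_{i\in I}\parallel\mathcal M'$; (Inside-In) if $\mathsf q\neq\mathrm{play}(\beta)$, $h\in I$ and $G_i\parallel\mathcal M\xrightarrow{\beta}G'_i\parallel\mathcal M'$ for all $i\in I$, then $\mathsf p\mathsf q?\{\lambda_i;G_i\}_{i\in I}\parallel\langle\mathsf p,\lambda_h,\mathsf q\rangle\cdot\mathcal M\xrightarrow{\beta}\mathsf p\mathsf q?\{\lambda_i;G'_i\}_{i\in I}\parallel\langle\mathsf p,\lambda_h,\mathsf q\rangle\cdot\mathcal M'$. *)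

theory Defs
  imports Main "HOL-Library.Finite_Map"
begin

text \<open>Participants and labels are the type parameters \<open>'p\<close> and \<open>'l\<close>.  A family
  \<open>{\<lambda>\<^sub>i; X\<^sub>i}\<close> indexed by a finite set, with pairwise distinct labels, is a
  finite map from labels.  The codatatypes below also contain non-regular terms and terms with
  empty choices; these are excluded by \<open>wf_proc\<close> and \<open>wf_gtype\<close>.\<close>

codatatype ('p, 'l) proc =
    PNil
  | POut 'p "('l, ('p, 'l) proc) fmap"
  | PIn 'p "('l, ('p, 'l) proc) fmap"

definition proc_conts :: "('p, 'l) proc \<Rightarrow> ('p, 'l) proc set" where
  "proc_conts P = (case P of PNil \<Rightarrow> {} | POut p \<Pi> \<Rightarrow> fmran' \<Pi> | PIn p \<Pi> \<Rightarrow> fmran' \<Pi>)"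

definition proc_subterms :: "('p, 'l) proc \<Rightarrow> ('p, 'l) proc set" where
  "proc_subterms P = {Q. (\<lambda>R S. S \<in> proc_conts R)\<^sup>*\<^sup>* P Q}"

text \<open>Regular means having finitely many distinct subterms.\<close>

definition wf_proc :: "('p, 'l) proc \<Rightarrow> bool" where
  "wf_proc P \<longleftrightarrow> finite (proc_subterms P) \<and>
     (\<forall>Q \<in> proc_subterms P. Q \<noteq> PNil \<longrightarrow> proc_conts Q \<noteq> {})"

text \<open>A network modulo permutation and addition or removal of components \<open>p[[0]]\<close> is a function
  with finite support, absent participants being mapped to \<open>PNil\<close>.  Thus \<open>p[[P]] \<parallel> N\<close> is
  \<open>N(p := P)\<close> for a network \<open>N\<close> with \<open>N p = PNil\<close>.\<close>

type_synonym ('p, 'l) network = "'p \<Rightarrow> ('p, 'l) proc"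

definition net_plays :: "('p, 'l) network \<Rightarrow> 'p set" where
  "net_plays N = {p. N p \<noteq> PNil}"

definition wf_network :: "('p, 'l) network \<Rightarrow> bool" where
  "wf_network N \<longleftrightarrow> finite (net_plays N) \<and> (\<forall>p. wf_proc (N p))"

text \<open>\<open>Msg p l q\<close> is the message \<open>\<langle>p, l, q\<rangle>\<close> from \<open>p\<close> to \<open>q\<close>.\<close>

datatype ('p, 'l) msg = Msg (sender: 'p) (label: 'l) (receiver: 'p)

inductive queue_cong :: "('p, 'l) msg list \<Rightarrow> ('p, 'l) msg list \<Rightarrow> bool" where
  swap: "sender m \<noteq> sender m' \<or> receiver m \<noteq> receiver m' \<Longrightarrow>
    queue_cong (xs @ [m, m'] @ ys) (xs @ [m', m] @ ys)"
| refl: "queue_cong xs xs"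
| sym: "queue_cong xs ys \<Longrightarrow> queue_cong ys xs"
| trans: "queue_cong xs ys \<Longrightarrow> queue_cong ys zs \<Longrightarrow> queue_cong xs zs"

lemma queue_cong_context:
  "queue_cong xs ys \<Longrightarrow> queue_cong (us @ xs @ vs) (us @ ys @ vs)"
proof (induction rule: queue_cong.induct)
  case (swap m m' xs ys)
  then show ?case
    using queue_cong.swap[of m m' "us @ xs" "ys @ vs"] by simp
qed (blast intro: queue_cong.intros)+

lemma queue_cong_append:
  assumes "queue_cong xs xs'" "queue_cong ys ys'"
  shows "queue_cong (xs @ ys) (xs' @ ys')"
  using queue_cong_context[OF assms(1), of "[]" ys] queue_cong_context[OF assms(2), of xs' "[]"]
  by (auto intro: queue_cong.trans)

quotient_type ('p, 'l) queue = "('p, 'l) msg list" / queue_cong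
  by (intro equivpI reflpI sympI transpI) (blast intro: queue_cong.intros)+

lift_definition queue_append :: "('p, 'l) queue \<Rightarrow> ('p, 'l) queue \<Rightarrow> ('p, 'l) queue"
  (infixr "\<cdot>" 65) is "(@)"
  by (rule queue_cong_append)

lift_definition queue_msg :: "'p \<Rightarrow> 'l \<Rightarrow> 'p \<Rightarrow> ('p, 'l) queue" ("\<langle>_, _, _\<rangle>")
  is "\<lambda>p l q. [Msg p l q]" .

text \<open>\<open>Snd p q l\<close> is \<open>pq!l\<close> and \<open>Rcv p q l\<close> is \<open>pq?l\<close>; in both, \<open>p\<close> is the sender and
  \<open>q\<close> the receiver.\<close>

datatype ('p, 'l) comm = Snd 'p 'p 'l | Rcv 'p 'p 'l

primrec comm_play :: "('p, 'l) comm \<Rightarrow> 'p" where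
  "comm_play (Snd p q l) = p"
| "comm_play (Rcv p q l) = q"

inductive session_step ::
  "('p, 'l) network \<Rightarrow> ('p, 'l) queue \<Rightarrow> ('p, 'l) comm \<Rightarrow>
   ('p, 'l) network \<Rightarrow> ('p, 'l) queue \<Rightarrow> bool" where
  send: "N p = PNil \<Longrightarrow> fmlookup \<Pi> l = Some P \<Longrightarrow>
    session_step (N(p := POut q \<Pi>)) M (Snd p q l) (N(p := P)) (M \<cdot> \<langle>p, l, q\<rangle>)"
| recv: "N q = PNil \<Longrightarrow> fmlookup \<Pi> l = Some Q \<Longrightarrow>
    session_step (N(q := PIn p \<Pi>)) (\<langle>p, l, q\<rangle> \<cdot> M) (Rcv p q l) (N(q := Q)) M"

text \<open>\<open>GOut p q \<Gamma>\<close> is \<open>pq!\<Gamma>\<close> and \<open>GIn p q \<Gamma>\<close> is \<open>pq?\<Gamma>\<close>; again \<open>p\<close> is the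
  sender and \<open>q\<close> the receiver.\<close>

codatatype ('p, 'l) gtype =
    GEnd
  | GOut 'p 'p "('l, ('p, 'l) gtype) fmap"
  | GIn 'p 'p "('l, ('p, 'l) gtype) fmap"

definition gtype_conts :: "('p, 'l) gtype \<Rightarrow> ('p, 'l) gtype set" where
  "gtype_conts G = (case G of GEnd \<Rightarrow> {} | GOut p q \<Gamma> \<Rightarrow> fmran' \<Gamma> | GIn p q \<Gamma> \<Rightarrow> fmran' \<Gamma>)"

definition gtype_subterms :: "('p, 'l) gtype \<Rightarrow> ('p, 'l) gtype set" where
  "gtype_subterms G = {H. (\<lambda>K L. L \<in> gtype_conts K)\<^sup>*\<^sup>* G H}"

definition wf_gtype :: "('p, 'l) gtype \<Rightarrow> bool" where
  "wf_gtype G \<longleftrightarrow> finite (gtype_subterms G) \<and>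
     (\<forall>H \<in> gtype_subterms G. H \<noteq> GEnd \<longrightarrow> gtype_conts H \<noteq> {}) \<and>
     (\<forall>p q \<Gamma>. GOut p q \<Gamma> \<in> gtype_subterms G \<or> GIn p q \<Gamma> \<in> gtype_subterms G \<longrightarrow> p \<noteq> q)"

inductive gtype_plays_in :: "'p \<Rightarrow> ('p, 'l) gtype \<Rightarrow> bool" where
  out: "gtype_plays_in p (GOut p q \<Gamma>)"
| inp: "gtype_plays_in q (GIn p q \<Gamma>)"
| cont: "H \<in> gtype_conts G \<Longrightarrow> gtype_plays_in r H \<Longrightarrow> gtype_plays_in r G"

definition gtype_plays :: "('p, 'l) gtype \<Rightarrow> 'p set" where
  "gtype_plays G = {p. gtype_plays_in p G}"

coinductive typed :: "('p, 'l) gtype \<Rightarrow> ('p, 'l) network \<Rightarrow> bool" ("\<turnstile> _ \<rhd> _" [60, 60] 50) where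
  End: "\<turnstile> GEnd \<rhd> (\<lambda>_. PNil)"
| Out: "N p = PNil \<Longrightarrow> fmdom \<Gamma> = fmdom \<Pi> \<Longrightarrow>
    \<forall>l G P. fmlookup \<Gamma> l = Some G \<longrightarrow> fmlookup \<Pi> l = Some P \<longrightarrow>
      (\<turnstile> G \<rhd> N(p := P)) \<and> gtype_plays G - {p} = net_plays N \<Longrightarrow>
    \<turnstile> GOut p q \<Gamma> \<rhd> N(p := POut q \<Pi>)"
| In: "N p = PNil \<Longrightarrow> fmdom \<Gamma> |\<subseteq>| fmdom \<Pi> \<Longrightarrow>
    \<forall>l G P. fmlookup \<Gamma> l = Some G \<longrightarrow> fmlookup \<Pi> l = Some P \<longrightarrow>
      (\<turnstile> G \<rhd> N(p := P)) \<and> gtype_plays G - {p} = net_plays N \<Longrightarrow>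
    \<turnstile> GIn q p \<Gamma> \<rhd> N(p := PIn q \<Pi>)"

inductive config_step ::
  "('p, 'l) gtype \<Rightarrow> ('p, 'l) queue \<Rightarrow> ('p, 'l) comm \<Rightarrow>
   ('p, 'l) gtype \<Rightarrow> ('p, 'l) queue \<Rightarrow> bool" where
  Top_Out: "fmlookup \<Gamma> l = Some G \<Longrightarrow>
    config_step (GOut p q \<Gamma>) M (Snd p q l) G (M \<cdot> \<langle>p, l, q\<rangle>)"
| Top_In: "fmlookup \<Gamma> l = Some G \<Longrightarrow>
    config_step (GIn p q \<Gamma>) (\<langle>p, l, q\<rangle> \<cdot> M) (Rcv p q l) G M"
| Inside_Out: "p \<noteq> comm_play \<beta> \<Longrightarrow> fmdom \<Gamma> = fmdom \<Gamma>' \<Longrightarrow>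
    \<forall>l G G'. fmlookup \<Gamma> l = Some G \<longrightarrow> fmlookup \<Gamma>' l = Some G' \<longrightarrow>
      config_step G (M \<cdot> \<langle>p, l, q\<rangle>) \<beta> G' (M' \<cdot> \<langle>p, l, q\<rangle>) \<Longrightarrow>
    config_step (GOut p q \<Gamma>) M \<beta> (GOut p q \<Gamma>') M'"
| Inside_In: "q \<noteq> comm_play \<beta> \<Longrightarrow> h |\<in>| fmdom \<Gamma> \<Longrightarrow> fmdom \<Gamma> = fmdom \<Gamma>' \<Longrightarrow>
    \<forall>l G G'. fmlookup \<Gamma> l = Some G \<longrightarrow> fmlookup \<Gamma>' l = Some G' \<longrightarrow>
      config_step G M \<beta> G' M' \<Longrightarrow>
    config_step (GIn p q \<Gamma>) (\<langle>p, h, q\<rangle> \<cdot> M) \<beta> (GIn p q \<Gamma>') (\<langle>p, h, q\<rangle> \<cdot> M')"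

text \<open>Transitions of a well-formed global type stay within well-formed global types.\<close>

lemma wf_gtype_unfold:
  "wf_gtype G \<longleftrightarrow> (\<forall>H \<in> gtype_conts G. wf_gtype H) \<and> finite (gtype_conts G) \<and>
     (G \<noteq> GEnd \<longrightarrow> gtype_conts G \<noteq> {}) \<and> (\<forall>p q \<Gamma>. G = GOut p q \<Gamma> \<or> G = GIn p q \<Gamma> \<longrightarrow> p \<noteq> q)"
proof -
  have sub: "gtype_subterms G = insert G (\<Union>H \<in> gtype_conts G. gtype_subterms H)"
    unfolding gtype_subterms_def
    by (auto intro: converse_rtranclp_into_rtranclp elim: converse_rtranclpE)
  have "H \<in> gtype_subterms H" for H :: "('a, 'b) gtype"
    by (simp add: gtype_subterms_def)
  then have "gtype_conts G \<subseteq> gtype_subterms G"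
    using sub by blast
  then have fin: "finite (gtype_subterms G) \<longleftrightarrow>
      finite (gtype_conts G) \<and> (\<forall>H \<in> gtype_conts G. finite (gtype_subterms H))"
    by (metis sub finite_UN finite_insert finite_subset)
  define ok :: "('a, 'b) gtype \<Rightarrow> bool" where
    "ok H \<longleftrightarrow> (H \<noteq> GEnd \<longrightarrow> gtype_conts H \<noteq> {}) \<and>
       (\<forall>p q \<Gamma>. H = GOut p q \<Gamma> \<or> H = GIn p q \<Gamma> \<longrightarrow> p \<noteq> q)" for H
  have wf: "wf_gtype H \<longleftrightarrow> finite (gtype_subterms H) \<and> (\<forall>K \<in> gtype_subterms H. ok K)" for H
    unfolding wf_gtype_def ok_def by metis
  have "(\<forall>K \<in> gtype_subterms G. ok K) \<longleftrightarrow> ok G \<and> (\<forall>H \<in> gtype_conts G. \<forall>K \<in> gtype_subterms H. ok K)"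
    by (subst sub) simp
  then have "wf_gtype G \<longleftrightarrow> (\<forall>H \<in> gtype_conts G. wf_gtype H) \<and> finite (gtype_conts G) \<and> ok G"
    unfolding wf fin by metis
  then show ?thesis
    by (simp only: ok_def)
qed

lemma wf_gtype_choice:
  "wf_gtype (GOut p q \<Gamma>) \<longleftrightarrow> p \<noteq> q \<and> fmdom \<Gamma> \<noteq> {||} \<and> (\<forall>l G. fmlookup \<Gamma> l = Some G \<longrightarrow> wf_gtype G)"
  "wf_gtype (GIn p q \<Gamma>) \<longleftrightarrow> p \<noteq> q \<and> fmdom \<Gamma> \<noteq> {||} \<and> (\<forall>l G. fmlookup \<Gamma> l = Some G \<longrightarrow> wf_gtype G)"
proof -
  have ne: "fmran' \<Gamma> \<noteq> {} \<longleftrightarrow> fmdom \<Gamma> \<noteq> {||}"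
    by (metis emptyE ex_in_conv fmlookup_dom_iff fmlookup_ran'_iff fempty_iff all_not_fin_conv)
  have fin: "finite (fmran' \<Gamma>)"
    by (simp add: fmran'_alt_def)
  show "wf_gtype (GOut p q \<Gamma>) \<longleftrightarrow> p \<noteq> q \<and> fmdom \<Gamma> \<noteq> {||} \<and> (\<forall>l G. fmlookup \<Gamma> l = Some G \<longrightarrow> wf_gtype G)"
    "wf_gtype (GIn p q \<Gamma>) \<longleftrightarrow> p \<noteq> q \<and> fmdom \<Gamma> \<noteq> {||} \<and> (\<forall>l G. fmlookup \<Gamma> l = Some G \<longrightarrow> wf_gtype G)"
    by (subst wf_gtype_unfold; auto simp: gtype_conts_def ne fin fmlookup_ran'_iff)+
qed

lemma config_step_wf_gtype:
  "config_step G M \<beta> G' M' \<Longrightarrow> wf_gtype G \<Longrightarrow> wf_gtype G'"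
proof (induction rule: config_step.induct)
  case (Inside_Out p \<beta> \<Gamma> \<Gamma>' M q M')
  then show ?case
    unfolding wf_gtype_choice by (metis fmlookup_dom_iff)
next
  case (Inside_In q \<beta> h \<Gamma> \<Gamma>' M M' p)
  then show ?case
    unfolding wf_gtype_choice by (metis fmlookup_dom_iff)
qed (auto simp: wf_gtype_choice)

end

theory Submission
  imports Defs
begin

text \<open>The proof is by induction on the transition of the type configuration.  In the inside cases
  every branch \<open>i\<close> yields a move of the same participant, different from the player \<open>p\<close> of the
  root; since this move is deterministic and does not touch \<open>p\<close>, the resulting networks agree up
  to the component of \<open>p\<close>, so they can be glued below the choice of \<open>p\<close>.  The side condition on
  plays is inherited because \<open>\<turnstile> G \<rhd> N\<close> forces \<open>G\<close> and \<open>N\<close> to have the same players.  On the side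
  of the queues, dropping the message of the root choice needs right cancellation, which holds
  because a queue is determined by its subsequences on the individual channels.\<close>

section \<open>Queues\<close>

definition channel :: "'p \<Rightarrow> 'p \<Rightarrow> ('p, 'l) msg list \<Rightarrow> ('p, 'l) msg list" where
  "channel p q = filter (\<lambda>m. sender m = p \<and> receiver m = q)"

lemma channel_append: "channel p q (xs @ ys) = channel p q xs @ channel p q ys"
  by (simp add: channel_def)

text \<open>A swap exchanges messages of different channels, so at most one of the two survives the
  filter.\<close>

lemma queue_cong_imp_channel_eq:
  "queue_cong xs ys \<Longrightarrow> channel p q xs = channel p q ys"
  by (induction rule: queue_cong.induct) (auto simp: channel_def)

text \<open>No message of \<open>us\<close> shares the channel of \<open>m\<close>, so
  \<open>m\<close> passes them one swap at a time.\<close>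

lemma queue_cong_move_front:
  assumes "\<forall>m' \<in> set us. sender m' \<noteq> sender m \<or> receiver m' \<noteq> receiver m"
  shows "queue_cong (us @ m # vs) (m # us @ vs)"
  using assms
proof (induction us)
  case Nil
  show ?case by (simp add: queue_cong.refl)
next
  case (Cons u us)
  then have "queue_cong (u # us @ m # vs) (u # m # us @ vs)"
    using queue_cong_context[of "us @ m # vs" "m # us @ vs" "[u]" "[]"] by simp
  moreover have "queue_cong (u # m # us @ vs) (m # u # us @ vs)"
    using Cons.prems queue_cong.swap[of u m "[]" "us @ vs"] by simp
  ultimately show ?case by (simp add: queue_cong.trans)
qed

text \<open>The head of \<open>xs\<close> is also the first message on its channel in
  \<open>ys\<close>; it can be brought to the front there, and the induction goes on with the two
  tails.\<close>

lemma channel_eq_imp_queue_cong: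
  assumes "\<And>p q. channel p q xs = channel p q ys"
  shows "queue_cong xs ys"
  using assms
proof (induction xs arbitrary: ys)
  case Nil
  have "ys = []"
  proof (cases ys)
    case (Cons y ys')
    then show ?thesis
      using Nil[of "sender y" "receiver y"] by (simp add: channel_def)
  qed
  then show ?case by (simp add: queue_cong.refl)
next
  case (Cons x xs)
  let ?c = "\<lambda>m. sender m = sender x \<and> receiver m = receiver x"
  have "filter ?c ys = x # filter ?c xs"
    using Cons.prems[of "sender x" "receiver x"] by (simp add: channel_def)
  \<comment> \<open>Split \<open>ys\<close> at its first message on the channel of \<open>x\<close>,
    so that nothing in \<open>us\<close> blocks \<open>x\<close>.\<close>
  then obtain us vs where ys: "ys = us @ x # vs" and us: "\<forall>u \<in> set us. \<not> ?c u"
    and "filter ?c xs = filter ?c vs"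
    by (auto simp: filter_eq_Cons_iff)
  have front: "queue_cong ys (x # us @ vs)"
    unfolding ys using us by (intro queue_cong_move_front) auto
  have "channel p q xs = channel p q (us @ vs)" for p q
    using Cons.prems[of p q] queue_cong_imp_channel_eq[OF front, of p q]
    by (simp add: channel_def split: if_splits)
  then have "queue_cong xs (us @ vs)"
    by (rule Cons.IH)
  then have "queue_cong (x # xs) (x # us @ vs)"
    using queue_cong_context[of xs "us @ vs" "[x]" "[]"] by simp
  then show ?case
    using front by (blast intro: queue_cong.intros)
qed

lemma queue_append_assoc: "(L \<cdot> M) \<cdot> M' = L \<cdot> M \<cdot> M'"
  by transfer (simp add: queue_cong.refl)

text \<open>Projection to a channel turns queue concatenation into list concatenation, which
  cancels.\<close>

lemma queue_append_right_cancel: "L \<cdot> M = L' \<cdot> M \<Longrightarrow> L = L'"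
proof transfer
  fix xs ys zs :: "('a, 'b) msg list"
  assume "queue_cong (xs @ zs) (ys @ zs)"
  then show "queue_cong xs ys"
    using queue_cong_imp_channel_eq[of "xs @ zs" "ys @ zs"]
    by (intro channel_eq_imp_queue_cong) (simp add: channel_append)
qed

lemma queue_msg_commute:
  assumes "p \<noteq> r \<or> q \<noteq> s"
  shows "\<langle>p, l, q\<rangle> \<cdot> \<langle>r, l', s\<rangle> = \<langle>r, l', s\<rangle> \<cdot> \<langle>p, l, q\<rangle>"
  using assms
proof transfer
  fix p r q s :: 'a and l l' :: 'b
  assume "p \<noteq> r \<or> q \<noteq> s"
  then show "queue_cong ([Msg p l q] @ [Msg r l' s]) ([Msg r l' s] @ [Msg p l q])"
    using queue_cong.swap[of "Msg p l q" "Msg r l' s" "[]" "[]"] by simp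
qed

section \<open>Session transitions\<close>

text \<open>A session transition is split into a network half and a queue half, so that the inside
  rules can change the context of each half separately.\<close>

primrec net_step ::
  "('p, 'l) network \<Rightarrow> ('p, 'l) comm \<Rightarrow> ('p, 'l) network \<Rightarrow> bool" where
  "net_step N (Snd p q l) N' \<longleftrightarrow>
     (\<exists>\<Pi> P. N p = POut q \<Pi> \<and> fmlookup \<Pi> l = Some P \<and> N' = N(p := P))"
| "net_step N (Rcv p q l) N' \<longleftrightarrow>
     (\<exists>\<Pi> P. N q = PIn p \<Pi> \<and> fmlookup \<Pi> l = Some P \<and> N' = N(q := P))"

primrec queue_step ::
  "('p, 'l) queue \<Rightarrow> ('p, 'l) comm \<Rightarrow> ('p, 'l) queue \<Rightarrow> bool" where
  "queue_step M (Snd p q l) M' \<longleftrightarrow> M' = M \<cdot> \<langle>p, l, q\<rangle>"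
| "queue_step M (Rcv p q l) M' \<longleftrightarrow> M = \<langle>p, l, q\<rangle> \<cdot> M'"

lemma session_step_iff:
  "session_step N M \<beta> N' M' \<longleftrightarrow> net_step N \<beta> N' \<and> queue_step M \<beta> M'"
proof
  assume "session_step N M \<beta> N' M'"
  then show "net_step N \<beta> N' \<and> queue_step M \<beta> M'"
    by cases auto
next
  assume step: "net_step N \<beta> N' \<and> queue_step M \<beta> M'"
  show "session_step N M \<beta> N' M'"
  proof (cases \<beta>)
    case (Snd p q l)
    with step obtain \<Pi> P where "N p = POut q \<Pi>" "fmlookup \<Pi> l = Some P" "N' = N(p := P)"
      "M' = M \<cdot> \<langle>p, l, q\<rangle>"
      by auto
    \<comment> \<open>Emptying the component of \<open>p\<close> yields the surrounding network that
      the rule asks for.\<close>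
    then show ?thesis
      using session_step.send[of "N(p := PNil)" p \<Pi> l P q M] Snd
      by (metis fun_upd_same fun_upd_triv fun_upd_upd)
  next
    case (Rcv p q l)
    with step obtain \<Pi> P where "N q = PIn p \<Pi>" "fmlookup \<Pi> l = Some P" "N' = N(q := P)"
      "M = \<langle>p, l, q\<rangle> \<cdot> M'"
      by auto
    then show ?thesis
      using session_step.recv[of "N(q := PNil)" q \<Pi> l P p M'] Rcv
      by (metis fun_upd_same fun_upd_triv fun_upd_upd)
  qed
qed

lemma net_step_deterministic: "net_step N \<beta> N' \<Longrightarrow> net_step N \<beta> N'' \<Longrightarrow> N' = N''"
  by (cases \<beta>) auto

text \<open>Only the component of the player of \<beta> is read or changed.\<close>

lemma net_step_frame:
  "net_step (N(p := P)) \<beta> N' \<Longrightarrow> p \<noteq> comm_play \<beta> \<Longrightarrow> net_step (N(p := P')) \<beta> (N'(p := P'))"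
  by (cases \<beta>) (auto simp: fun_upd_twist)

lemma wf_proc_cont:
  assumes "wf_proc P" "Q \<in> proc_conts P"
  shows "wf_proc Q"
proof -
  have "proc_subterms Q \<subseteq> proc_subterms P"
    using assms(2) by (auto simp: proc_subterms_def intro: converse_rtranclp_into_rtranclp)
  then show ?thesis
    using assms(1) by (auto simp: wf_proc_def intro: finite_subset)
qed

lemma net_step_wf_network:
  assumes "net_step N \<beta> N'" "wf_network N"
  shows "wf_network N'"
proof -
  \<comment> \<open>Either kind of communication replaces one component by one of its own
    continuations.\<close>
  obtain r R where R: "R \<in> proc_conts (N r)" "N' = N(r := R)"
    using assms(1) by (cases \<beta>) (force simp: proc_conts_def fmlookup_ran'_iff)+
  have "net_plays N' \<subseteq> insert r (net_plays N)"
    by (auto simp: R net_plays_def)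
  then show ?thesis
    using assms(2) R wf_proc_cont[OF _ R(1)]
    by (auto simp: wf_network_def intro: finite_subset)
qed

text \<open>Serves \<open>Inside_Out\<close>, whose premises append the message of the root choice
  to both queues.\<close>

lemma queue_step_drop_last:
  assumes "queue_step (M \<cdot> \<langle>p, l, q\<rangle>) \<beta> (M' \<cdot> \<langle>p, l, q\<rangle>)" "p \<noteq> comm_play \<beta>"
  shows "queue_step M \<beta> M'"
proof (cases \<beta>)
  case (Snd r s l')
  \<comment> \<open>The sender \<open>r\<close> of the new message differs from \<open>p\<close>, so
    the two messages commute and the root message is last on both sides.\<close>
  then have "M' \<cdot> \<langle>p, l, q\<rangle> = (M \<cdot> \<langle>r, l', s\<rangle>) \<cdot> \<langle>p, l, q\<rangle>"
    using assms queue_msg_commute[of p r q s l l'] by (simp add: queue_append_assoc)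
  then show ?thesis
    using Snd queue_append_right_cancel by auto
next
  case (Rcv r s l')
  then have "M \<cdot> \<langle>p, l, q\<rangle> = (\<langle>r, l', s\<rangle> \<cdot> M') \<cdot> \<langle>p, l, q\<rangle>"
    using assms by (simp add: queue_append_assoc)
  then show ?thesis
    using Rcv queue_append_right_cancel by auto
qed

text \<open>Serves \<open>Inside_In\<close>: a received message has a receiver other than
  \<open>q\<close>, so it can overtake the added one, while a sent message goes to the other
  end.\<close>

lemma queue_step_add_first:
  assumes "queue_step M \<beta> M'" "q \<noteq> comm_play \<beta>"
  shows "queue_step (\<langle>p, l, q\<rangle> \<cdot> M) \<beta> (\<langle>p, l, q\<rangle> \<cdot> M')"
proof (cases \<beta>)
  case (Snd r s l')
  then show ?thesis
    using assms by (simp add: queue_append_assoc)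
next
  case (Rcv r s l')
  then show ?thesis
    using assms queue_msg_commute[of p r q s l l'] by (simp flip: queue_append_assoc)
qed

section \<open>Typing\<close>

lemma gtype_plays_GOut: "gtype_plays (GOut p q \<Gamma>) = insert p (\<Union>G \<in> fmran' \<Gamma>. gtype_plays G)"
  by (auto simp: gtype_plays_def gtype_conts_def intro: gtype_plays_in.intros
      elim: gtype_plays_in.cases)

lemma gtype_plays_GIn: "gtype_plays (GIn p q \<Gamma>) = insert q (\<Union>G \<in> fmran' \<Gamma>. gtype_plays G)"
  by (auto simp: gtype_plays_def gtype_conts_def intro: gtype_plays_in.intros
      elim: gtype_plays_in.cases)

lemma gtype_plays_GEnd: "gtype_plays GEnd = {}"
  by (auto simp: gtype_plays_def gtype_conts_def elim: gtype_plays_in.cases)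

lemma typed_GOutE:
  assumes "\<turnstile> GOut p q \<Gamma> \<rhd> N"
  obtains N0 \<Pi> where "N = N0(p := POut q \<Pi>)" "N0 p = PNil"
    "fmdom \<Gamma> = fmdom \<Pi>"
    "\<forall>l G P. fmlookup \<Gamma> l = Some G \<longrightarrow> fmlookup \<Pi> l = Some P \<longrightarrow>
      (\<turnstile> G \<rhd> N0(p := P)) \<and> gtype_plays G - {p} = net_plays N0"
  using assms by cases auto

lemma typed_GInE:
  assumes "\<turnstile> GIn q p \<Gamma> \<rhd> N"
  obtains N0 \<Pi> where "N = N0(p := PIn q \<Pi>)" "N0 p = PNil"
    "fmdom \<Gamma> |\<subseteq>| fmdom \<Pi>"
    "\<forall>l G P. fmlookup \<Gamma> l = Some G \<longrightarrow> fmlookup \<Pi> l = Some P \<longrightarrow>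
      (\<turnstile> G \<rhd> N0(p := P)) \<and> gtype_plays G - {p} = net_plays N0"
  using assms by cases auto

lemma insert_UN_eq:
  assumes "A \<noteq> {}" "\<And>x. x \<in> A \<Longrightarrow> f x - {p} = B"
  shows "insert p (\<Union>x \<in> A. f x) = insert p B"
  using assms by blast

text \<open>One inversion suffices, without induction: the side condition of the typing rule already
  fixes the players of every branch up to the root player.\<close>

lemma typed_plays:
  assumes "\<turnstile> G \<rhd> N" "wf_gtype G"
  shows "gtype_plays G = net_plays N"
proof -
  \<comment> \<open>For an empty choice the side condition would be vacuous and would say nothing
    about the rest of the network.\<close>
  have ne: "fmran' \<Gamma> \<noteq> {}" if "fmdom \<Gamma> \<noteq> {||}" for \<Gamma> :: "('b, ('a, 'b) gtype) fmap"
    using that by (metis all_not_fin_conv emptyE fmlookup_dom_iff fmlookup_ran'_iff)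
  show ?thesis
  proof (cases G)
    case GEnd
    with assms(1) show ?thesis
      by cases (auto simp: gtype_plays_GEnd net_plays_def)
  next
    case (GOut p q \<Gamma>)
    from assms(1)[unfolded GOut] obtain N0 \<Pi> where N:
      "N = N0(p := POut q \<Pi>)" "N0 p = PNil" "fmdom \<Gamma> = fmdom \<Pi>"
      "\<forall>l G P. fmlookup \<Gamma> l = Some G \<longrightarrow> fmlookup \<Pi> l = Some P \<longrightarrow>
        (\<turnstile> G \<rhd> N0(p := P)) \<and> gtype_plays G - {p} = net_plays N0"
      by (rule typed_GOutE)
    have "gtype_plays G - {p} = net_plays N0" if "G \<in> fmran' \<Gamma>" for G
      using that N(3,4) by (metis fmlookup_dom_iff fmlookup_ran'_iff)
    then have "gtype_plays G = insert p (net_plays N0)"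
      using assms(2) GOut by (simp add: wf_gtype_choice gtype_plays_GOut insert_UN_eq ne)
    then show ?thesis
      by (auto simp: N(1) net_plays_def)
  next
    case (GIn q p \<Gamma>)
    from assms(1)[unfolded GIn] obtain N0 \<Pi> where N:
      "N = N0(p := PIn q \<Pi>)" "N0 p = PNil" "fmdom \<Gamma> |\<subseteq>| fmdom \<Pi>"
      "\<forall>l G P. fmlookup \<Gamma> l = Some G \<longrightarrow> fmlookup \<Pi> l = Some P \<longrightarrow>
        (\<turnstile> G \<rhd> N0(p := P)) \<and> gtype_plays G - {p} = net_plays N0"
      by (rule typed_GInE)
    have "gtype_plays G - {p} = net_plays N0" if "G \<in> fmran' \<Gamma>" for G
      using that N(3,4) by (metis fmlookup_dom_iff fmlookup_ran'_iff fsubsetD)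
    then have "gtype_plays G = insert p (net_plays N0)"
      using assms(2) GIn by (simp add: wf_gtype_choice gtype_plays_GIn insert_UN_eq ne)
    then show ?thesis
      by (auto simp: N(1) net_plays_def)
  qed
qed

text \<open>The gluing common to both inside cases: \<Gamma> holds the reduced branches, \<Pi> the
  processes of the root player \<open>p\<close>, and \<open>N\<close> the network around
  \<open>p\<close>. One \<open>N'\<close> serves all branches.\<close>

lemma net_step_branches:
  assumes p: "p \<noteq> comm_play \<beta>"
    and \<Gamma>: "fmdom \<Gamma> \<noteq> {||}" "fmdom \<Gamma> |\<subseteq>| fmdom \<Pi>"
    and wf: "\<And>l G. fmlookup \<Gamma> l = Some G \<Longrightarrow> wf_gtype G"
    and step: "\<And>l G P. fmlookup \<Gamma> l = Some G \<Longrightarrow> fmlookup \<Pi> l = Some P \<Longrightarrow>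
      \<exists>N'. net_step (N(p := P)) \<beta> N' \<and> \<turnstile> G \<rhd> N'"
  obtains N' where "N' p = PNil" "\<forall>P. net_step (N(p := P)) \<beta> (N'(p := P))"
    "\<forall>l G P. fmlookup \<Gamma> l = Some G \<longrightarrow> fmlookup \<Pi> l = Some P \<longrightarrow>
      (\<turnstile> G \<rhd> N'(p := P)) \<and> gtype_plays G - {p} = net_plays N'"
proof -
  obtain l0 where l0: "l0 |\<in>| fmdom \<Gamma>"
    using \<Gamma>(1) by blast
  then have "l0 |\<in>| fmdom \<Pi>"
    using \<Gamma>(2) by blast
  \<comment> \<open>The move of one branch is framed to every process of \<open>p\<close>.\<close>
  with l0 obtain P0 N0 where "net_step (N(p := P0)) \<beta> N0"
    using step by (metis fmlookup_dom_iff)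
  then have any: "net_step (N(p := P)) \<beta> (N0(p := P))" for P
    using p by (rule net_step_frame)
  \<comment> \<open>\<open>N0\<close> still holds \<open>P0\<close> at \<open>p\<close>; erasing it
    gives the context that the typing rules require.\<close>
  define N' where "N' = N0(p := PNil)"
  have "(\<turnstile> G \<rhd> N'(p := P)) \<and> gtype_plays G - {p} = net_plays N'"
    if l: "fmlookup \<Gamma> l = Some G" "fmlookup \<Pi> l = Some P" for l G P
  proof -
    \<comment> \<open>By determinism the network typed in this branch is the framed one.\<close>
    have typed: "\<turnstile> G \<rhd> N'(p := P)"
      using step[OF l] net_step_deterministic[OF any] by (auto simp: N'_def)
    then have "gtype_plays G = net_plays (N'(p := P))"
      using wf[OF l(1)] by (rule typed_plays)
    with typed show ?thesis
      by (auto simp: N'_def net_plays_def)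
  qed
  then show ?thesis
    using that[of N'] any by (simp add: N'_def)
qed

text \<open>\<open>N\<close> is generalized because each branch is typed with its own process at the
  root player.\<close>

lemma config_step_net_step:
  assumes "config_step G M \<beta> G' M'" "wf_gtype G" "\<turnstile> G \<rhd> N"
  shows "\<exists>N'. net_step N \<beta> N' \<and> queue_step M \<beta> M' \<and> \<turnstile> G' \<rhd> N'"
  using assms
proof (induction arbitrary: N rule: config_step.induct)
  case (Top_Out \<Gamma> l G p q M)
  from Top_Out.prems(2) obtain N0 \<Pi> where N: "N = N0(p := POut q \<Pi>)" "N0 p = PNil"
    "fmdom \<Gamma> = fmdom \<Pi>"
    "\<forall>l G P. fmlookup \<Gamma> l = Some G \<longrightarrow> fmlookup \<Pi> l = Some P \<longrightarrow>
      (\<turnstile> G \<rhd> N0(p := P)) \<and> gtype_plays G - {p} = net_plays N0"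
    by (rule typed_GOutE)
  obtain P where P: "fmlookup \<Pi> l = Some P"
    using Top_Out.hyps N(3) by (metis fmlookup_dom_iff)
  have "N p = POut q \<Pi>" "N0(p := P) = N(p := P)"
    unfolding N(1) by (rule fun_upd_same, rule fun_upd_upd[symmetric])
  with P have "net_step N (Snd p q l) (N0(p := P))"
    unfolding net_step.simps by blast
  moreover have "queue_step M (Snd p q l) (M \<cdot> \<langle>p, l, q\<rangle>)"
    by simp
  ultimately show ?case
    using N(4)[rule_format, OF Top_Out.hyps P] by blast
next
  case (Top_In \<Gamma> l G p q M)
  from Top_In.prems(2) obtain N0 \<Pi> where N: "N = N0(q := PIn p \<Pi>)" "N0 q = PNil"
    "fmdom \<Gamma> |\<subseteq>| fmdom \<Pi>"
    "\<forall>l G P. fmlookup \<Gamma> l = Some G \<longrightarrow> fmlookup \<Pi> l = Some P \<longrightarrow>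
      (\<turnstile> G \<rhd> N0(q := P)) \<and> gtype_plays G - {q} = net_plays N0"
    by (rule typed_GInE)
  obtain P where P: "fmlookup \<Pi> l = Some P"
    using Top_In.hyps N(3) by (metis fmlookup_dom_iff fsubsetD)
  have "N q = PIn p \<Pi>" "N0(q := P) = N(q := P)"
    unfolding N(1) by (rule fun_upd_same, rule fun_upd_upd[symmetric])
  with P have "net_step N (Rcv p q l) (N0(q := P))"
    unfolding net_step.simps by blast
  moreover have "queue_step (\<langle>p, l, q\<rangle> \<cdot> M) (Rcv p q l) M"
    by simp
  ultimately show ?case
    using N(4)[rule_format, OF Top_In.hyps P] by blast
next
  case (Inside_Out p \<beta> \<Gamma> \<Gamma>' M q M')
  from Inside_Out.prems(2) obtain N0 \<Pi> where N: "N = N0(p := POut q \<Pi>)" "N0 p = PNil"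
    "fmdom \<Gamma> = fmdom \<Pi>"
    "\<forall>l G P. fmlookup \<Gamma> l = Some G \<longrightarrow> fmlookup \<Pi> l = Some P \<longrightarrow>
      (\<turnstile> G \<rhd> N0(p := P)) \<and> gtype_plays G - {p} = net_plays N0"
    by (rule typed_GOutE)
  have branch: "\<exists>N'. net_step (N0(p := P)) \<beta> N' \<and> queue_step M \<beta> M' \<and> (\<turnstile> G' \<rhd> N') \<and> wf_gtype G'"
    if l: "fmlookup \<Gamma>' l = Some G'" "fmlookup \<Pi> l = Some P" for l G' P
  proof -
    obtain G where G: "fmlookup \<Gamma> l = Some G"
      using l(1) Inside_Out.hyps(2) by (metis fmlookup_dom_iff)
    then have wf: "wf_gtype G"
      using Inside_Out.prems(1) by (auto simp: wf_gtype_choice)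
    \<comment> \<open>The quantified premise makes the induction hypothesis a conjunction of the
      branch transition and the claim for it.\<close>
    have step: "config_step G (M \<cdot> \<langle>p, l, q\<rangle>) \<beta> G' (M' \<cdot> \<langle>p, l, q\<rangle>)"
      using Inside_Out.IH[rule_format, OF G l(1)] by (rule conjunct1)
    obtain N' where "net_step (N0(p := P)) \<beta> N'" "\<turnstile> G' \<rhd> N'"
      "queue_step (M \<cdot> \<langle>p, l, q\<rangle>) \<beta> (M' \<cdot> \<langle>p, l, q\<rangle>)"
      using Inside_Out.IH[rule_format, OF G l(1), THEN conjunct2, rule_format,
          OF wf N(4)[rule_format, OF G l(2), THEN conjunct1]]
      by blast
    then show ?thesis
      using queue_step_drop_last[OF _ Inside_Out.hyps(1)] config_step_wf_gtype[OF step wf] by blast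
  qed
  have ne: "fmdom \<Gamma>' \<noteq> {||}"
    using Inside_Out by (simp add: wf_gtype_choice)
  obtain N' where N': "N' p = PNil" "\<forall>P. net_step (N0(p := P)) \<beta> (N'(p := P))"
    "\<forall>l G P. fmlookup \<Gamma>' l = Some G \<longrightarrow> fmlookup \<Pi> l = Some P \<longrightarrow>
      (\<turnstile> G \<rhd> N'(p := P)) \<and> gtype_plays G - {p} = net_plays N'"
  proof (rule net_step_branches[of p \<beta> \<Gamma>' \<Pi> N0])
    show "wf_gtype G" if "fmlookup \<Gamma>' l = Some G" for l G
      using that branch Inside_Out.hyps(2) N(3) by (metis fmlookup_dom_iff)
    show "fmdom \<Gamma>' |\<subseteq>| fmdom \<Pi>"
      using N(3) Inside_Out.hyps(2) by simp
    show "\<exists>N'. net_step (N0(p := P)) \<beta> N' \<and> \<turnstile> G \<rhd> N'"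
      if "fmlookup \<Gamma>' l = Some G" "fmlookup \<Pi> l = Some P" for l G P
      using branch[OF that] by blast
  qed (rule Inside_Out.hyps(1) ne)+
  \<comment> \<open>The queue move is the same in all branches, so it is read off any one of
    them.\<close>
  have "queue_step M \<beta> M'"
    using branch ne Inside_Out.hyps(2) N(3) by (metis fmlookup_dom_iff all_not_fin_conv)
  \<comment> \<open>The root player does not act, so it keeps its choice
    \<open>POut q \<Pi>\<close>; framing at this process also gives the move of
    \<open>N\<close>.\<close>
  moreover have "\<turnstile> GOut p q \<Gamma>' \<rhd> N'(p := POut q \<Pi>)"
    by (rule typed.Out[OF N'(1) _ N'(3)]) (simp add: N(3) flip: Inside_Out.hyps(2))
  ultimately show ?case
    using N'(2) unfolding N(1) by blast
next
  case (Inside_In q \<beta> h \<Gamma> \<Gamma>' M M' p)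
  from Inside_In.prems(2) obtain N0 \<Pi> where N: "N = N0(q := PIn p \<Pi>)" "N0 q = PNil"
    "fmdom \<Gamma> |\<subseteq>| fmdom \<Pi>"
    "\<forall>l G P. fmlookup \<Gamma> l = Some G \<longrightarrow> fmlookup \<Pi> l = Some P \<longrightarrow>
      (\<turnstile> G \<rhd> N0(q := P)) \<and> gtype_plays G - {q} = net_plays N0"
    by (rule typed_GInE)
  have branch: "\<exists>N'. net_step (N0(q := P)) \<beta> N' \<and> queue_step M \<beta> M' \<and> (\<turnstile> G' \<rhd> N') \<and> wf_gtype G'"
    if l: "fmlookup \<Gamma>' l = Some G'" "fmlookup \<Pi> l = Some P" for l G' P
  proof -
    obtain G where G: "fmlookup \<Gamma> l = Some G"
      using l(1) Inside_In.hyps(3) by (metis fmlookup_dom_iff)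
    then have wf: "wf_gtype G"
      using Inside_In.prems(1) by (auto simp: wf_gtype_choice)
    have step: "config_step G M \<beta> G' M'"
      using Inside_In.IH[rule_format, OF G l(1)] by (rule conjunct1)
    obtain N' where "net_step (N0(q := P)) \<beta> N'" "\<turnstile> G' \<rhd> N'" "queue_step M \<beta> M'"
      using Inside_In.IH[rule_format, OF G l(1), THEN conjunct2, rule_format,
          OF wf N(4)[rule_format, OF G l(2), THEN conjunct1]]
      by blast
    then show ?thesis
      using config_step_wf_gtype[OF step wf] by blast
  qed
  \<comment> \<open>The label \<open>h\<close> of the queued root message is a branch.\<close>
  have ne: "fmdom \<Gamma>' \<noteq> {||}"
    using Inside_In.hyps by auto
  obtain N' where N': "N' q = PNil" "\<forall>P. net_step (N0(q := P)) \<beta> (N'(q := P))"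
    "\<forall>l G P. fmlookup \<Gamma>' l = Some G \<longrightarrow> fmlookup \<Pi> l = Some P \<longrightarrow>
      (\<turnstile> G \<rhd> N'(q := P)) \<and> gtype_plays G - {q} = net_plays N'"
  proof (rule net_step_branches[of q \<beta> \<Gamma>' \<Pi> N0])
    show "wf_gtype G" if "fmlookup \<Gamma>' l = Some G" for l G
      using that branch Inside_In.hyps(3) N(3) by (metis fmlookup_dom_iff fsubsetD)
    show "fmdom \<Gamma>' |\<subseteq>| fmdom \<Pi>"
      using N(3) Inside_In.hyps(3) by simp
    show "\<exists>N'. net_step (N0(q := P)) \<beta> N' \<and> \<turnstile> G \<rhd> N'"
      if "fmlookup \<Gamma>' l = Some G" "fmlookup \<Pi> l = Some P" for l G P
      using branch[OF that] by blast
  qed (rule Inside_In.hyps(1) ne)+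
  have "queue_step M \<beta> M'"
    using branch Inside_In.hyps(2,3) N(3) by (metis fmlookup_dom_iff fsubsetD)
  \<comment> \<open>The branches move without the root message, which is now put back in
    front.\<close>
  then have "queue_step (\<langle>p, h, q\<rangle> \<cdot> M) \<beta> (\<langle>p, h, q\<rangle> \<cdot> M')"
    using Inside_In.hyps(1) by (rule queue_step_add_first)
  moreover have "\<turnstile> GIn p q \<Gamma>' \<rhd> N'(q := PIn p \<Pi>)"
    by (rule typed.In[OF N'(1) _ N'(3)]) (simp add: N(3) flip: Inside_In.hyps(3))
  ultimately show ?case
    using N'(2) unfolding N(1) by blast
qed

theorem theorem3p9:
  fixes G G' :: "('p, 'l) gtype" and N :: "('p, 'l) network"
    and M M' :: "('p, 'l) queue" and \<beta> :: "('p, 'l) comm"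
  assumes "wf_gtype G" and "wf_network N"
    and "\<turnstile> G \<rhd> N"
    and "config_step G M \<beta> G' M'"
  shows "\<exists>N'. wf_network N' \<and> session_step N M \<beta> N' M' \<and> \<turnstile> G' \<rhd> N'"
proof -
  obtain N' where "net_step N \<beta> N'" "queue_step M \<beta> M'" "\<turnstile> G' \<rhd> N'"
    using config_step_net_step assms by blast
  then show ?thesis
    using net_step_wf_network[OF _ assms(2)] by (auto simp: session_step_iff)
qed

end
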